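(* In the base model, let $\pi^*=\max\{\pi(x,y): x\in\{0,1\}^n,y\in\{0,1\}^m\}$. Let $\pi^p$ be the optimal value of the same problem for the modified instance in which all $q_j$ ($j\in\mathbf M$) are replaced by $0$, and $\pi^q$ the optimal value for the modified instance in which all $p_i$ ($i\in\mathbf N$) are replaced by $0$ (all other data unchanged). Let $(x^{\mathrm{ARO}},y^{\mathrm{ARO}})$ be an optimal solution of the first modified instance if $\pi^p\ge\pi^q$, and an optimal solution of the second modified instance otherwise. Then $\pi(x^{\mathrm{ARO}},y^{\mathrm{ARO}})\ge 0.5\,\pi^*$, where $\pi$ is the revenue function of the original instance.
   Context: Base model. Let $n,m$ be positive integers, $\mathbf N=\{1,\dots,n\}$, $\mathbf M=\{1,\dots,m\}$, $\mathbf N_+=\mathbf N\cup\{0\}$, $\mathbf M_+=\mathbf M\cup\{0\}$. Prices $p_i\ge 0$ ($i\in\mathbf N$), $q_j\ge 0$ ($j\in\mathbf M$), $p_0=q_0=0$. Preference weights $u_{ij}\ge 0$ for $(i,j)\in\mathbf N_+\times\mathbf M_+$, with $u_{00}=1$. For an assortment $(x,y)\in\{0,1\}^n\times\{0,1\}^m$, set $x_0=y_0=1$ and $$\pi(x,y)=\frac{\sum_{i\in\mathbf N_+,j\in\mathbf M_+}u_{ij}x_iy_j(p_i+q_j)}{\sum_{i\in\mathbf N_+,j\in\mathbf M_+}u_{ij}x_iy_j}.$$ *)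

theory Defs
  imports Complex_Main "HOL-Library.FuncSet"
begin

definition assortments :: "nat \<Rightarrow> (nat \<Rightarrow> real) set" where
  "assortments n = {1..n} \<rightarrow>\<^sub>E {0, 1}"

text \<open>The update at index 0 realises the convention \<open>x\<^sub>0 = y\<^sub>0 = 1\<close>.\<close>

definition revenue ::
  "nat \<Rightarrow> nat \<Rightarrow> (nat \<Rightarrow> nat \<Rightarrow> real) \<Rightarrow> (nat \<Rightarrow> real) \<Rightarrow> (nat \<Rightarrow> real) \<Rightarrow>
    (nat \<Rightarrow> real) \<Rightarrow> (nat \<Rightarrow> real) \<Rightarrow> real" where
  "revenue n m u p q x y =
    (\<Sum>i=0..n. \<Sum>j=0..m. u i j * (x(0 := 1)) i * (y(0 := 1)) j * (p i + q j)) /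
    (\<Sum>i=0..n. \<Sum>j=0..m. u i j * (x(0 := 1)) i * (y(0 := 1)) j)"

definition opt_revenue ::
  "nat \<Rightarrow> nat \<Rightarrow> (nat \<Rightarrow> nat \<Rightarrow> real) \<Rightarrow> (nat \<Rightarrow> real) \<Rightarrow> (nat \<Rightarrow> real) \<Rightarrow> real" where
  "opt_revenue n m u p q =
    Max {revenue n m u p q x y | x y. x \<in> assortments n \<and> y \<in> assortments m}"

definition optimal_solution ::
  "nat \<Rightarrow> nat \<Rightarrow> (nat \<Rightarrow> nat \<Rightarrow> real) \<Rightarrow> (nat \<Rightarrow> real) \<Rightarrow> (nat \<Rightarrow> real) \<Rightarrow>
    (nat \<Rightarrow> real) \<Rightarrow> (nat \<Rightarrow> real) \<Rightarrow> bool" where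
  "optimal_solution n m u p q x y \<longleftrightarrow>
    x \<in> assortments n \<and> y \<in> assortments m \<and>
    (\<forall>x' \<in> assortments n. \<forall>y' \<in> assortments m.
      revenue n m u p q x' y' \<le> revenue n m u p q x y)"

lemma finite_assortments: "finite (assortments n)"
  unfolding assortments_def by (intro finite_PiE) auto

lemma assortments_nonempty: "assortments n \<noteq> {}"
  by (simp add: assortments_def PiE_eq_empty_iff)

text \<open>The set whose \<open>Max\<close> defines \<open>opt_revenue\<close> is finite and nonempty,
  so this \<open>Max\<close> is a genuine maximum.\<close>

lemma revenue_values_eq_image:
  "{revenue n m u p q x y | x y. x \<in> assortments n \<and> y \<in> assortments m} =
    (\<lambda>(x, y). revenue n m u p q x y) ` (assortments n \<times> assortments m)"
  by auto

lemma finite_revenue_values: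
  "finite {revenue n m u p q x y | x y. x \<in> assortments n \<and> y \<in> assortments m}"
  unfolding revenue_values_eq_image by (simp add: finite_assortments)

lemma revenue_values_nonempty:
  "{revenue n m u p q x y | x y. x \<in> assortments n \<and> y \<in> assortments m} \<noteq> {}"
  unfolding revenue_values_eq_image by (simp add: assortments_nonempty)

end

theory Submission
  imports Defs
begin

text \<open>The revenue is additive in the price data: it is the sum of the revenues of the two modified
  instances, both nonnegative. Hence \<open>\<pi>\<^sup>* \<le> \<pi>\<^sup>p + \<pi>\<^sup>q \<le> 2 max(\<pi>\<^sup>p, \<pi>\<^sup>q)\<close>, and a solution that attains
  this maximum earns at least as much under the original prices.\<close>

lemma revenue_split:
  "revenue n m u p q x y = revenue n m u p (\<lambda>_. 0) x y + revenue n m u (\<lambda>_. 0) q x y"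
  unfolding revenue_def
  \<comment> \<open>The denominator contains no prices, so only the numerator splits;
    \<open>add_divide_distrib\<close> covers every denominator, as division by 0 yields 0.\<close>
  by (simp only: distrib_left sum.distrib add_divide_distrib add_0_left add_0_right
      mult_zero_right)

text \<open>With \<open>revenue_split\<close>, this shows that restoring the prices set to 0 never
  lowers the revenue of a fixed assortment.\<close>

lemma revenue_nonneg:
  assumes "\<And>i. i \<in> {0..n} \<Longrightarrow> p i \<ge> 0" and "\<And>j. j \<in> {0..m} \<Longrightarrow> q j \<ge> 0"
    and "\<And>i j. i \<in> {0..n} \<Longrightarrow> j \<in> {0..m} \<Longrightarrow> u i j \<ge> 0"
    and x: "x \<in> assortments n" and y: "y \<in> assortments m"
  shows "revenue n m u p q x y \<ge> 0"
proof -
  \<comment> \<open>Membership gives values 0 or 1 only on \<open>{1..k}\<close>; at index 0 the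
    update supplies 1.\<close>
  have nonneg: "(z(0 := 1)) i \<ge> 0" if "z \<in> assortments k" "i \<in> {0..k}"
    for z :: "nat \<Rightarrow> real" and k i
  proof (cases "i = 0")
    case False
    then have "z i \<in> {0, 1}"
      using that PiE_mem[of z "{1..k}" "\<lambda>_. {0, 1}" i] by (simp add: assortments_def)
    then show ?thesis using False by auto
  qed simp
  show ?thesis
    unfolding revenue_def
    by (intro divide_nonneg_nonneg sum_nonneg mult_nonneg_nonneg add_nonneg_nonneg
        nonneg[OF x] nonneg[OF y] assms)
qed

lemma opt_revenue_upper:
  assumes "x \<in> assortments n" and "y \<in> assortments m"
  shows "revenue n m u p q x y \<le> opt_revenue n m u p q"
  unfolding opt_revenue_def using assms by (intro Max_ge finite_revenue_values) auto

lemma opt_revenue_least: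
  assumes "\<And>x y. x \<in> assortments n \<Longrightarrow> y \<in> assortments m \<Longrightarrow> revenue n m u p q x y \<le> c"
  shows "opt_revenue n m u p q \<le> c"
  unfolding opt_revenue_def
  using assms Max_in[OF finite_revenue_values revenue_values_nonempty, of n m u p q] by auto

text \<open>The two parts of a revenue are bounded separately; the optima on the right may be
  attained at different assortments, hence only an inequality.\<close>

lemma opt_revenue_subadditive:
  "opt_revenue n m u p q \<le> opt_revenue n m u p (\<lambda>_. 0) + opt_revenue n m u (\<lambda>_. 0) q"
  by (rule opt_revenue_least) (subst revenue_split, intro add_mono opt_revenue_upper)

lemma opt_revenue_le_optimal_solution:
  assumes "optimal_solution n m u p q x y"
  shows "opt_revenue n m u p q \<le> revenue n m u p q x y"
  using assms by (intro opt_revenue_least) (auto simp: optimal_solution_def)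

theorem theorem2:
  fixes n m :: nat
    and p q :: "nat \<Rightarrow> real"
    and u :: "nat \<Rightarrow> nat \<Rightarrow> real"
    and xARO yARO :: "nat \<Rightarrow> real"
  assumes "n \<ge> 1" and "m \<ge> 1"
    and "p 0 = 0" and "q 0 = 0"
    and "\<And>i. i \<in> {1..n} \<Longrightarrow> p i \<ge> 0"
    and "\<And>j. j \<in> {1..m} \<Longrightarrow> q j \<ge> 0"
    and "u 0 0 = 1"
    and "\<And>i j. i \<in> {0..n} \<Longrightarrow> j \<in> {0..m} \<Longrightarrow> u i j \<ge> 0"
    and "if opt_revenue n m u p (\<lambda>_. 0) \<ge> opt_revenue n m u (\<lambda>_. 0) q
         then optimal_solution n m u p (\<lambda>_. 0) xARO yARO
         else optimal_solution n m u (\<lambda>_. 0) q xARO yARO"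
  shows "revenue n m u p q xARO yARO \<ge> 0.5 * opt_revenue n m u p q"
proof -
  let ?P = "opt_revenue n m u p (\<lambda>_. 0)" and ?Q = "opt_revenue n m u (\<lambda>_. 0) q"
  have p: "p i \<ge> 0" if "i \<in> {0..n}" for i
    using that assms(3,5) by (cases "i = 0") auto
  have q: "q j \<ge> 0" if "j \<in> {0..m}" for j
    using that assms(4,6) by (cases "j = 0") auto
  have mem: "xARO \<in> assortments n" "yARO \<in> assortments m"
    using assms(9) by (auto simp: optimal_solution_def split: if_splits)
  have "revenue n m u p (\<lambda>_. 0) xARO yARO \<ge> 0" "revenue n m u (\<lambda>_. 0) q xARO yARO \<ge> 0"
    by (rule revenue_nonneg; simp add: p q assms(8) mem)+
  \<comment> \<open>The chosen solution attains the larger modified optimum, and the branch taken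
    decides which disjunct holds. In either case the other part of the revenue is nonnegative, so
    the total is at least \<open>max ?P ?Q\<close>.\<close>
  moreover have "max ?P ?Q \<le> revenue n m u p (\<lambda>_. 0) xARO yARO
      \<or> max ?P ?Q \<le> revenue n m u (\<lambda>_. 0) q xARO yARO"
    using assms(9) by (auto split: if_splits dest!: opt_revenue_le_optimal_solution)
  ultimately show ?thesis
    using opt_revenue_subadditive[of n m u p q] revenue_split[of n m u p q xARO yARO]
    by auto
qed

end
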